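(* Consider the linear time-invariant system $\dot{x}(t) = A x(t) + B u(t) + E w(t)$ with $A \in \mathbb{R}^{n\times n}$, $B \in \mathbb{R}^{n\times m}$, $E \in \mathbb{R}^{n\times r}$, input set $\mathcal{U}\subset\mathbb{R}^m$ and disturbance set $\mathcal{W}\subset\mathbb{R}^r$ (both zonotopes), and a target set $\mathcal{X}_{\text{end}}\subset\mathbb{R}^n$ given as a polytope. For every time $t \in [0,t_{\text{end}}]$, the time-point AE backward reachable set $$\mathcal{R}^{\forall\exists}(-t) := \big\{ x_0 \in \mathbb{R}^n \,\big|\, \forall u(\cdot)\in\mathbb{U}\; \exists w(\cdot)\in\mathbb{W}\colon \xi(t;x_0,u(\cdot),w(\cdot)) \in \mathcal{X}_{\text{end}} \big\}$$ satisfies $$\mathcal{R}^{\forall\exists}(-t) = e^{-At}\Big( \big( \mathcal{X}_{\text{end}} \oplus -\mathcal{Z}_{\mathcal{W}}(t) \big) \ominus \mathcal{Z}_{\mathcal{U}}(t) \Big).$$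
   Context: $\mathbb{U}$ is the set of all (measurable) input trajectories $u:[0,t_{\text{end}}]\to\mathcal{U}$ and $\mathbb{W}$ the set of all (measurable) disturbance trajectories $w:[0,t_{\text{end}}]\to\mathcal{W}$. $\xi(t;x_0,u(\cdot),w(\cdot)) = e^{At}x_0 + \int_0^t e^{A(t-\theta)}(Bu(\theta)+Ew(\theta))\,\mathrm{d}\theta$ is the solution at time $t$. For a set $\mathcal{S}\subset\mathbb{R}^n$, the particular solution is $\mathcal{Z}_{\mathcal{S}}(t) := \{\int_0^t e^{A(t-\theta)} s(\theta)\,\mathrm{d}\theta \mid s(\theta)\in\mathcal{S}\}$ (over measurable $s$), and $\mathcal{Z}_{\mathcal{U}}(t) := \mathcal{Z}_{B\mathcal{U}}(t)$, $\mathcal{Z}_{\mathcal{W}}(t) := \mathcal{Z}_{E\mathcal{W}}(t)$, where $B\mathcal{U}=\{Bu\mid u\in\mathcal{U}\}$. Set operations: $M\mathcal{S} = \{Ms \mid s\in\mathcal{S}\}$; $-\mathcal{S} = \{-s\mid s\in\mathcal{S}\}$; Minkowski sum $\mathcal{S}_1\oplus\mathcal{S}_2 = \{s_1+s_2\mid s_1\in\mathcal{S}_1, s_2\in\mathcal{S}_2\}$; Minkowski difference $\mathcal{S}_1\ominus\mathcal{S}_2 = \{s \mid \{s\}\oplus\mathcal{S}_2\subseteq\mathcal{S}_1\}$. A zonotope is $\{c+\sum_{i=1}^{\gamma} G_{(\cdot,i)}\alpha_i \mid \alpha_i\in[-1,1]\}$ for $c\in\mathbb{R}^n$, $G\in\mathbb{R}^{n\times\gamma}$;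 a polytope is $\{s \mid Ns\le d\}$ for $N\in\mathbb{R}^{c\times n}$, $d\in\mathbb{R}^c$. *)

theory Defs
  imports "HOL-Analysis.Analysis"
begin

section \<open>Matrix exponential\<close>

primrec matpow :: "real^'n^'n \<Rightarrow> nat \<Rightarrow> real^'n^'n" where
  "matpow M 0 = mat 1"
| "matpow M (Suc k) = M ** matpow M k"

text \<open>Matrix exponential via its power series e^M = sum_k M^k / k!.\<close>
definition mexp :: "real^'n^'n \<Rightarrow> real^'n^'n" where
  "mexp M = (\<Sum>k. (1 / (fact k :: real)) *\<^sub>R matpow M k)"

section \<open>Set operations\<close>

definition lin_image :: "real^'a^'b \<Rightarrow> (real^'a) set \<Rightarrow> (real^'b) set" where
  "lin_image M S = {M *v s | s. s \<in> S}"

definition set_neg :: "('a::ab_group_add) set \<Rightarrow> 'a set" where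
  "set_neg S = {- s | s. s \<in> S}"

definition mink_sum :: "('a::ab_group_add) set \<Rightarrow> 'a set \<Rightarrow> 'a set" where
  "mink_sum S1 S2 = {s1 + s2 | s1 s2. s1 \<in> S1 \<and> s2 \<in> S2}"

definition mink_diff :: "('a::ab_group_add) set \<Rightarrow> 'a set \<Rightarrow> 'a set" where
  "mink_diff S1 S2 = {s. mink_sum {s} S2 \<subseteq> S1}"

section \<open>Zonotopes and polytopes\<close>

text \<open>Zonotope with center c and finitely many generators (columns of G).\<close>
definition is_zonotope :: "(real^'n) set \<Rightarrow> bool" where
  "is_zonotope S \<longleftrightarrow> (\<exists>(c::real^'n) (gs::(real^'n) list).
     S = {c + (\<Sum>i<length gs. \<alpha> i *\<^sub>R gs ! i) | \<alpha>. \<forall>i<length gs. \<alpha> i \<in> {-1..1}})"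

text \<open>Polytope {s | N s <= d}: rows of N paired with entries of d.\<close>
definition is_polytope :: "(real^'n) set \<Rightarrow> bool" where
  "is_polytope S \<longleftrightarrow> (\<exists>(N::((real^'n) \<times> real) list).
     S = {s. \<forall>(a, b) \<in> set N. a \<bullet> s \<le> b})"

section \<open>Trajectories, solutions, particular solutions\<close>

text \<open>Measurable trajectories on [0,T] with values in S.\<close>
definition trajs :: "real \<Rightarrow> ('a::euclidean_space) set \<Rightarrow> (real \<Rightarrow> 'a) set" where
  "trajs T S = {f. f \<in> borel_measurable (lebesgue_on {0..T}) \<and> (\<forall>\<theta>\<in>{0..T}. f \<theta> \<in> S)}"

definition sol :: "real^'n^'n \<Rightarrow> real^'m^'n \<Rightarrow> real^'r^'n \<Rightarrow> real \<Rightarrow> real^'n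
    \<Rightarrow> (real \<Rightarrow> real^'m) \<Rightarrow> (real \<Rightarrow> real^'r) \<Rightarrow> real^'n" where
  "sol A B E t x0 u w = mexp (t *\<^sub>R A) *v x0
     + integral {0..t} (\<lambda>\<theta>. mexp ((t - \<theta>) *\<^sub>R A) *v (B *v u \<theta> + E *v w \<theta>))"

definition partsol :: "real^'n^'n \<Rightarrow> (real^'n) set \<Rightarrow> real \<Rightarrow> (real^'n) set" where
  "partsol A S t = {integral {0..t} (\<lambda>\<theta>. mexp ((t - \<theta>) *\<^sub>R A) *v s \<theta>) | s. s \<in> trajs t S}"

definition AE_backreach :: "real^'n^'n \<Rightarrow> real^'m^'n \<Rightarrow> real^'r^'n \<Rightarrow> (real^'m) set
    \<Rightarrow> (real^'r) set \<Rightarrow> (real^'n) set \<Rightarrow> real \<Rightarrow> real \<Rightarrow> (real^'n) set" where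
  "AE_backreach A B E U W Xend tend t = {x0. \<forall>u \<in> trajs tend U. \<exists>w \<in> trajs tend W.
      sol A B E t x0 u w \<in> Xend}"

end

theory Submission
  imports Defs
begin

(*
  Write y = e^(tA) x0. Since zonotopes are compact, the integrands in the solution are
  integrable, so the solution splits as y plus the forced responses
  int_0^t e^((t - s) A) v(s) ds to v = Bu and v = Ew. The forced responses to admissible
  inputs u form exactly Z_U(t); the nontrivial inclusion needs every measurable s with values in
  BU to lift to a measurable u with values in U and Bu = s. Such a lift comes from a Borel choice
  of zonotope coefficients: choose one coefficient after the other as the least admissible value,
  which is Borel because its sublevel sets are projections of compact sets. After that,
  "for all u there is w with y + z_u + z_w in X_end" says literally that y lies in the Minkowski
  difference of X_end + (-Z_W(t)) and Z_U(t), and e^(-tA) inverts e^(tA).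
*)

section \<open>The matrix exponential as a Banach algebra exponential\<close>

(* In HOL-Analysis real^'n^'n is a ring only under componentwise multiplication; matrices are
   therefore embedded into the Banach algebra of bounded linear endomorphisms, whose exp is
   available. *)
typedef (overloaded) ('n::finite) endo = "UNIV :: ((real^'n) \<Rightarrow>\<^sub>L (real^'n)) set" by simp
setup_lifting type_definition_endo

instantiation endo :: (finite) real_normed_vector
begin
lift_definition norm_endo :: "'a endo \<Rightarrow> real" is norm .
lift_definition minus_endo :: "'a endo \<Rightarrow> 'a endo \<Rightarrow> 'a endo" is "(-)" .
lift_definition plus_endo :: "'a endo \<Rightarrow> 'a endo \<Rightarrow> 'a endo" is "(+)" .
lift_definition uminus_endo :: "'a endo \<Rightarrow> 'a endo" is "uminus" .
lift_definition zero_endo :: "'a endo" is "0" .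
lift_definition scaleR_endo :: "real \<Rightarrow> 'a endo \<Rightarrow> 'a endo" is "scaleR" .
definition dist_endo :: "'a endo \<Rightarrow> 'a endo \<Rightarrow> real" where "dist_endo a b = norm (a - b)"
definition uniformity_endo :: "('a endo \<times> 'a endo) filter" where
  "uniformity_endo = (INF e\<in>{0 <..}. principal {(x, y). dist x y < e})"
definition open_endo :: "'a endo set \<Rightarrow> bool"
  where "open_endo S = (\<forall>x\<in>S. \<forall>\<^sub>F (x', y) in uniformity. x' = x \<longrightarrow> y \<in> S)"
definition sgn_endo :: "'a endo \<Rightarrow> 'a endo" where "sgn_endo x = scaleR (inverse (norm x)) x"
instance
  by standard
    (unfold dist_endo_def open_endo_def sgn_endo_def uniformity_endo_def,
     (rule refl | (transfer, force simp: algebra_simps norm_triangle_ineq))+)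
end

instantiation endo :: (finite) real_normed_algebra_1
begin
lift_definition times_endo :: "'a endo \<Rightarrow> 'a endo \<Rightarrow> 'a endo" is blinfun_compose .
lift_definition one_endo :: "'a endo" is id_blinfun .
instance
proof
  show "(0 :: 'a endo) \<noteq> 1"
    by transfer (metis blinfun_apply_id_blinfun blinfun.zero_left one_neq_zero)
  show "norm (1 :: 'a endo) = 1"
    by transfer simp
  show "norm (x * y) \<le> norm x * norm y" for x y :: "'a endo"
    by transfer (rule norm_blinfun_compose)
qed (transfer, rule blinfun_eqI,
    simp add: blinfun.add_left blinfun.add_right blinfun.scaleR_left blinfun.scaleR_right)+
end

lemma dist_endo_eq: "dist x y = dist (Rep_endo x) (Rep_endo y)"
  by (simp add: dist_endo_def dist_norm norm_endo.rep_eq minus_endo.rep_eq)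

instance endo :: (finite) banach
proof
  fix X :: "nat \<Rightarrow> 'a endo"
  assume "Cauchy X"
  then have "Cauchy (\<lambda>n. Rep_endo (X n))"
    by (simp add: Cauchy_def dist_endo_eq)
  then obtain L where "(\<lambda>n. Rep_endo (X n)) \<longlonglongrightarrow> L"
    using Cauchy_convergent_iff convergent_def by blast
  then have "X \<longlonglongrightarrow> Abs_endo L"
    by (simp add: lim_sequentially dist_endo_eq Abs_endo_inverse)
  then show "convergent X"
    by (auto simp: convergent_def)
qed

definition endo_of_matrix :: "real^'n^'n \<Rightarrow> 'n endo" where
  "endo_of_matrix M = Abs_endo (Blinfun (\<lambda>x. M *v x))"

definition matrix_of_endo :: "'n endo \<Rightarrow> real^'n^'n" where
  "matrix_of_endo X = matrix (blinfun_apply (Rep_endo X))"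

lemma endo_eqI: "(\<And>x. blinfun_apply (Rep_endo X) x = blinfun_apply (Rep_endo Y) x) \<Longrightarrow> X = Y"
  by (metis Rep_endo_inject blinfun_eqI)

lemma endo_of_matrix_apply: "blinfun_apply (Rep_endo (endo_of_matrix M)) x = M *v x"
  by (simp add: endo_of_matrix_def Abs_endo_inverse bounded_linear_Blinfun_apply)

lemma matrix_of_endo_apply: "matrix_of_endo X *v x = blinfun_apply (Rep_endo X) x"
  unfolding matrix_of_endo_def by (metis blinfun.bounded_linear_right matrix_vector_mul(3))

lemma matrix_of_endo_of_matrix: "matrix_of_endo (endo_of_matrix M) = M"
  by (simp add: matrix_eq matrix_of_endo_apply endo_of_matrix_apply)

lemma endo_of_matrix_of_endo: "endo_of_matrix (matrix_of_endo X) = X"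
  by (rule endo_eqI) (simp add: matrix_of_endo_apply endo_of_matrix_apply)

lemma endo_of_matrix_mult: "endo_of_matrix (M ** N) = endo_of_matrix M * endo_of_matrix N"
  by (rule endo_eqI) (simp add: endo_of_matrix_apply times_endo.rep_eq matrix_vector_mul_assoc)

lemma endo_of_matrix_one: "endo_of_matrix (mat 1) = 1"
  by (rule endo_eqI) (simp add: endo_of_matrix_apply one_endo.rep_eq)

lemma endo_of_matrix_add: "endo_of_matrix (M + N) = endo_of_matrix M + endo_of_matrix N"
  by (rule endo_eqI)
    (simp add: endo_of_matrix_apply plus_endo.rep_eq blinfun.add_left matrix_vector_mult_add_rdistrib)

lemma endo_of_matrix_scaleR: "endo_of_matrix (r *\<^sub>R M) = r *\<^sub>R endo_of_matrix M"
  by (rule endo_eqI)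
    (simp add: endo_of_matrix_apply scaleR_endo.rep_eq blinfun.scaleR_left flip: scaleR_matrix_vector_assoc)

lemma endo_of_matrix_matpow: "endo_of_matrix (matpow M k) = endo_of_matrix M ^ k"
  by (induction k) (simp_all add: endo_of_matrix_one endo_of_matrix_mult)

lemma matrix_of_endo_mult: "matrix_of_endo (X * Y) = matrix_of_endo X ** matrix_of_endo Y"
  by (metis endo_of_matrix_mult endo_of_matrix_of_endo matrix_of_endo_of_matrix)

lemma bounded_linear_matrix_of_endo: "bounded_linear (matrix_of_endo :: 'n endo \<Rightarrow> real^'n^'n)"
proof (rule bounded_linear_intro[where K = "real (CARD('n) * CARD('n))"])
  fix X Y :: "'n endo" and r :: real
  show "matrix_of_endo (X + Y) = matrix_of_endo X + matrix_of_endo Y"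
    by (metis endo_of_matrix_add endo_of_matrix_of_endo matrix_of_endo_of_matrix)
  show "matrix_of_endo (r *\<^sub>R X) = r *\<^sub>R matrix_of_endo X"
    by (metis endo_of_matrix_scaleR endo_of_matrix_of_endo matrix_of_endo_of_matrix)
  have "(*v) (matrix_of_endo X) = blinfun_apply (Rep_endo X)"
    by (rule ext) (rule matrix_of_endo_apply)
  then have entry: "\<bar>matrix_of_endo X $ i $ j\<bar> \<le> norm X" for i j
    using matrix_component_le_onorm[of "matrix_of_endo X" i j]
    by (simp add: norm_endo.rep_eq norm_blinfun.rep_eq)
  have "norm (matrix_of_endo X) \<le> (\<Sum>i\<in>UNIV. norm (matrix_of_endo X $ i))"
    unfolding norm_vec_def by (rule L2_set_le_sum) simp
  also have "\<dots> \<le> (\<Sum>i\<in>(UNIV::'n set). \<Sum>j\<in>(UNIV::'n set). norm X)"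
    by (intro sum_mono order_trans[OF norm_le_l1_cart] entry)
  finally show "norm (matrix_of_endo X) \<le> norm X * real (CARD('n) * CARD('n))"
    by (simp add: mult_ac)
qed

lemma mexp_eq_exp_endo: "mexp M = matrix_of_endo (exp (endo_of_matrix M))"
proof -
  have "(\<lambda>k. endo_of_matrix M ^ k /\<^sub>R fact k) sums exp (endo_of_matrix M)"
    unfolding exp_def by (rule summable_sums, rule summable_exp_generic)
  then have "(\<lambda>k. matrix_of_endo (endo_of_matrix M ^ k /\<^sub>R fact k)) sums
      matrix_of_endo (exp (endo_of_matrix M))"
    by (rule bounded_linear.sums[OF bounded_linear_matrix_of_endo])
  moreover have "matrix_of_endo (endo_of_matrix M ^ k /\<^sub>R fact k) = (1 / fact k) *\<^sub>R matpow M k" for k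
    by (simp add: divide_inverse_commute matrix_of_endo_of_matrix
        flip: endo_of_matrix_matpow endo_of_matrix_scaleR)
  ultimately show ?thesis
    unfolding mexp_def by (simp add: sums_iff)
qed

lemma mexp_uminus_mult: "mexp (- M) ** mexp M = mat 1"
proof -
  have "endo_of_matrix (- M) = - endo_of_matrix M"
    using endo_of_matrix_scaleR[of "- 1" M] by simp
  then have "mexp (- M) ** mexp M =
      matrix_of_endo (exp (- endo_of_matrix M) * exp (endo_of_matrix M))"
    by (simp add: mexp_eq_exp_endo matrix_of_endo_mult)
  also have "\<dots> = matrix_of_endo 1"
    using exp_minus_inverse[of "- endo_of_matrix M"] by simp
  also have "\<dots> = mat 1"
    by (metis endo_of_matrix_one matrix_of_endo_of_matrix)
  finally show ?thesis .
qed

lemma mexp_scaleR_inverse: "mexp ((- t) *\<^sub>R A) *v (mexp (t *\<^sub>R A) *v x) = x"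
  by (simp add: matrix_vector_mul_assoc mexp_uminus_mult)

lemma continuous_on_mexp_scaleR: "continuous_on S (\<lambda>s::real. mexp (s *\<^sub>R M))"
proof -
  have "continuous_on S (\<lambda>s::real. exp (s *\<^sub>R endo_of_matrix M))"
    using exp_scaleR_has_vector_derivative_right has_vector_derivative_continuous
    by (metis continuous_at_imp_continuous_on)
  then have "continuous_on S (\<lambda>s. matrix_of_endo (exp (s *\<^sub>R endo_of_matrix M)))"
    by (intro continuous_on_compose2[OF linear_continuous_on[OF bounded_linear_matrix_of_endo]]) auto
  then show ?thesis
    by (simp add: mexp_eq_exp_endo endo_of_matrix_scaleR)
qed

section \<open>Set operations\<close>

lemma lin_image_eq_image: "lin_image B S = (*v) B ` S"
  by (auto simp: lin_image_def)

lemma mem_mink_diff_iff: "y \<in> mink_diff S Y \<longleftrightarrow> (\<forall>p\<in>Y. y + p \<in> S)"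
  unfolding mink_diff_def mink_sum_def by blast

lemma mem_mink_sum_set_neg_iff: "v \<in> mink_sum X (set_neg Z) \<longleftrightarrow> (\<exists>q\<in>Z. v + q \<in> X)"
proof
  assume "v \<in> mink_sum X (set_neg Z)"
  then obtain x q where "x \<in> X" "q \<in> Z" "v = x + - q"
    unfolding mink_sum_def set_neg_def by blast
  then show "\<exists>q\<in>Z. v + q \<in> X"
    by (intro bexI[of _ q]) simp_all
next
  assume "\<exists>q\<in>Z. v + q \<in> X"
  then obtain q where "q \<in> Z" "v + q \<in> X"
    by blast
  then have "(v + q) + - q \<in> mink_sum X (set_neg Z)"
    unfolding mink_sum_def set_neg_def by blast
  then show "v \<in> mink_sum X (set_neg Z)"
    by simp
qed

lemma mem_lin_image_inverse_iff:
  assumes "\<And>x. M *v (N *v x) = x" "\<And>x. N *v (M *v x) = x"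
  shows "x \<in> lin_image N S \<longleftrightarrow> M *v x \<in> S"
proof
  assume "x \<in> lin_image N S"
  then obtain s where "s \<in> S" "x = N *v s"
    by (auto simp: lin_image_def)
  then show "M *v x \<in> S"
    by (simp add: assms(1))
next
  assume "M *v x \<in> S"
  then show "x \<in> lin_image N S"
    unfolding lin_image_def by (auto simp: assms(2) intro!: exI[of _ "M *v x"])
qed

section \<open>Zonotopes\<close>

definition zonotope :: "'a::real_vector list \<Rightarrow> 'a set" where
  "zonotope gs = (\<lambda>\<alpha>. \<Sum>i<length gs. \<alpha> i *\<^sub>R gs ! i) ` {\<alpha>. \<forall>i<length gs. \<alpha> i \<in> {-1..1}}"

lemma is_zonotopeE:
  assumes "is_zonotope S"
  obtains c gs where "S = (+) c ` zonotope gs"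
proof -
  obtain c gs where "S = {c + (\<Sum>i<length gs. \<alpha> i *\<^sub>R gs ! i) | \<alpha>. \<forall>i<length gs. \<alpha> i \<in> {-1..1}}"
    using assms unfolding is_zonotope_def by blast
  then have "S = (+) c ` zonotope gs"
    unfolding zonotope_def image_image by blast
  then show ?thesis
    using that by blast
qed

lemma zonotope_Nil: "zonotope [] = {0}"
  by (auto simp: zonotope_def)

lemma zonotope_Cons: "zonotope (g # gs) = (\<lambda>(b, y). b *\<^sub>R g + y) ` ({-1..1} \<times> zonotope gs)"
proof (intro set_eqI iffI)
  fix z assume "z \<in> zonotope (g # gs)"
  then obtain \<alpha> where \<alpha>: "\<forall>i<Suc (length gs). \<alpha> i \<in> {-1..1}"
    and z: "z = (\<Sum>i<Suc (length gs). \<alpha> i *\<^sub>R (g # gs) ! i)"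
    by (auto simp: zonotope_def)
  have "z = \<alpha> 0 *\<^sub>R g + (\<Sum>i<length gs. \<alpha> (Suc i) *\<^sub>R gs ! i)"
    unfolding z sum.lessThan_Suc_shift by simp
  moreover have "(\<Sum>i<length gs. \<alpha> (Suc i) *\<^sub>R gs ! i) \<in> zonotope gs"
    using \<alpha> unfolding zonotope_def by (intro image_eqI[where x = "\<lambda>i. \<alpha> (Suc i)"]) auto
  moreover have "\<alpha> 0 \<in> {-1..1}"
    using \<alpha> by blast
  ultimately show "z \<in> (\<lambda>(b, y). b *\<^sub>R g + y) ` ({-1..1} \<times> zonotope gs)"
    by (intro image_eqI[where x = "(\<alpha> 0, \<Sum>i<length gs. \<alpha> (Suc i) *\<^sub>R gs ! i)"]) auto
next
  fix z assume "z \<in> (\<lambda>(b, y). b *\<^sub>R g + y) ` ({-1..1} \<times> zonotope gs)"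
  then obtain b \<beta> where b: "b \<in> {-1..1}" and \<beta>: "\<forall>i<length gs. \<beta> i \<in> {-1..1}"
    and z: "z = b *\<^sub>R g + (\<Sum>i<length gs. \<beta> i *\<^sub>R gs ! i)"
    by (auto simp: zonotope_def)
  define \<alpha> where "\<alpha> = case_nat b \<beta>"
  have "z = (\<Sum>i<Suc (length gs). \<alpha> i *\<^sub>R (g # gs) ! i)"
    unfolding z sum.lessThan_Suc_shift by (simp add: \<alpha>_def)
  moreover have "\<forall>i<Suc (length gs). \<alpha> i \<in> {-1..1}"
    using b \<beta> by (auto simp: \<alpha>_def split: nat.split)
  ultimately show "z \<in> zonotope (g # gs)"
    unfolding zonotope_def by (intro image_eqI[where x = \<alpha>]) auto
qed

lemma zero_in_zonotope: "0 \<in> zonotope gs"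
  unfolding zonotope_def by (rule image_eqI[where x = "\<lambda>_. 0"]) auto

lemma compact_zonotope: "compact (zonotope (gs :: 'a::real_normed_vector list))"
proof (induction gs)
  case Nil
  then show ?case
    by (simp add: zonotope_Nil)
next
  case (Cons g gs)
  then show ?case
    unfolding zonotope_Cons case_prod_unfold
    by (intro compact_continuous_image compact_Times compact_Icc continuous_intros)
qed

lemma lin_image_translated_zonotope:
  "lin_image B ((+) c ` zonotope gs) = (+) (B *v c) ` zonotope (map ((*v) B) gs)"
proof -
  have "B *v (\<Sum>i<length gs. \<alpha> i *\<^sub>R gs ! i) =
      (\<Sum>i<length gs. \<alpha> i *\<^sub>R map ((*v) B) gs ! i)" for \<alpha>
    by (simp add: linear_sum[OF matrix_vector_mul_linear] matrix_vector_mult_scaleR)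
  then have image: "(*v) B ` zonotope gs = zonotope (map ((*v) B) gs)"
    unfolding zonotope_def image_image by simp
  have "lin_image B ((+) c ` zonotope gs) = (+) (B *v c) ` ((*v) B ` zonotope gs)"
    by (simp add: lin_image_eq_image image_image matrix_vector_right_distrib)
  then show ?thesis
    by (simp only: image)
qed

lemma compact_lin_image_zonotope:
  assumes "is_zonotope U"
  shows "compact (lin_image B U)"
proof -
  obtain c gs where "U = (+) c ` zonotope gs"
    using assms by (rule is_zonotopeE)
  then show ?thesis
    by (simp add: lin_image_translated_zonotope compact_translation compact_zonotope)
qed

section \<open>Borel selections\<close>

lemma compact_measurable_section:
  fixes P :: "('a::metric_space \<times> real) set"
  assumes P: "compact P"
  obtains \<beta> where "\<beta> \<in> borel_measurable borel" "\<And>z. z \<in> fst ` P \<Longrightarrow> (z, \<beta> z) \<in> P"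
proof
  define \<beta> where "\<beta> z = (if z \<in> fst ` P then Inf {b. (z, b) \<in> P} else 0)" for z
  have "bdd_below (snd ` P)"
    by (intro bounded_imp_bdd_below compact_imp_bounded compact_continuous_image
        continuous_on_snd continuous_on_id P)
  then have bdd: "bdd_below {b. (z, b) \<in> P}" for z
    by (rule bdd_below_mono) (auto intro: rev_image_eqI)
  have "closed (Pair z -` P)" for z
    by (intro continuous_closed_vimage compact_imp_closed P continuous_intros)
  then have closed: "closed {b. (z, b) \<in> P}" for z
    by (simp add: vimage_def)
  show mem: "(z, \<beta> z) \<in> P" if "z \<in> fst ` P" for z
  proof -
    have "{b. (z, b) \<in> P} \<noteq> {}"
      using that by force
    then show ?thesis
      using closed_contains_Inf[OF _ bdd closed] that by (simp add: \<beta>_def)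
  qed
  have le_iff: "\<beta> z \<le> r \<longleftrightarrow> z \<in> fst ` (P \<inter> UNIV \<times> {..r})" if "z \<in> fst ` P" for z r
  proof
    assume "\<beta> z \<le> r"
    then show "z \<in> fst ` (P \<inter> UNIV \<times> {..r})"
      using mem[OF that] by (intro rev_image_eqI[of "(z, \<beta> z)"]) auto
  next
    assume "z \<in> fst ` (P \<inter> UNIV \<times> {..r})"
    then obtain b where "(z, b) \<in> P" "b \<le> r"
      by auto
    then show "\<beta> z \<le> r"
      using cInf_lower[OF _ bdd, of b z] that by (simp add: \<beta>_def)
  qed
  have "{z. \<beta> z \<le> r} = fst ` (P \<inter> UNIV \<times> {..r}) \<union> (if 0 \<le> r then - fst ` P else {})" for r
    using le_iff by (auto simp: \<beta>_def)
  moreover have "closed (fst ` (P \<inter> UNIV \<times> {..r}))" "closed (fst ` P)" for r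
    by (intro compact_imp_closed compact_continuous_image continuous_on_fst continuous_on_id
        compact_Int_closed closed_Times P closed_UNIV closed_atMost)+
  ultimately show "\<beta> \<in> borel_measurable borel"
    by (auto simp: borel_measurable_iff_le)
qed

lemma zonotope_Cons_measurable_coefficient:
  fixes gs :: "'a::euclidean_space list"
  obtains \<beta> where "\<beta> \<in> borel_measurable borel"
    and "\<And>z. z \<in> zonotope (g # gs) \<Longrightarrow> \<beta> z \<in> {-1..1} \<and> z - \<beta> z *\<^sub>R g \<in> zonotope gs"
proof -
  define P where "P = (\<lambda>(b, y). (b *\<^sub>R g + y, b)) ` ({-1..1} \<times> zonotope gs)"
  have "compact P"
    unfolding P_def case_prod_unfold
    by (intro compact_continuous_image compact_Times compact_Icc compact_zonotope continuous_intros)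
  moreover have "fst ` P = zonotope (g # gs)"
    by (simp add: P_def zonotope_Cons image_image case_prod_unfold)
  ultimately obtain \<beta> where \<beta>_meas: "\<beta> \<in> borel_measurable borel"
    and \<beta>_P: "\<And>z. z \<in> zonotope (g # gs) \<Longrightarrow> (z, \<beta> z) \<in> P"
    by (metis compact_measurable_section)
  have "\<beta> z \<in> {-1..1} \<and> z - \<beta> z *\<^sub>R g \<in> zonotope gs" if "z \<in> zonotope (g # gs)" for z
    using \<beta>_P[OF that] by (auto simp: P_def)
  with \<beta>_meas show ?thesis
    by (rule that)
qed

lemma zonotope_measurable_coefficients:
  fixes gs :: "'a::euclidean_space list"
  shows "\<exists>a :: 'a \<Rightarrow> nat \<Rightarrow> real. (\<forall>i. (\<lambda>z. a z i) \<in> borel_measurable borel) \<and>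
    (\<forall>z\<in>zonotope gs. (\<forall>i<length gs. a z i \<in> {-1..1}) \<and> z = (\<Sum>i<length gs. a z i *\<^sub>R gs ! i))"
proof (induction gs)
  case Nil
  show ?case
    by (rule exI[of _ "\<lambda>z i. 0"]) (simp add: zonotope_Nil)
next
  case (Cons g gs)
  then obtain a :: "'a \<Rightarrow> nat \<Rightarrow> real"
    where a_meas: "\<And>i. (\<lambda>z. a z i) \<in> borel_measurable borel"
      and a: "\<And>z. z \<in> zonotope gs \<Longrightarrow>
        (\<forall>i<length gs. a z i \<in> {-1..1}) \<and> z = (\<Sum>i<length gs. a z i *\<^sub>R gs ! i)"
    by blast
  obtain \<beta> where \<beta>_meas: "\<beta> \<in> borel_measurable borel"
    and \<beta>: "\<And>z. z \<in> zonotope (g # gs) \<Longrightarrow> \<beta> z \<in> {-1..1} \<and> z - \<beta> z *\<^sub>R g \<in> zonotope gs"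
    using zonotope_Cons_measurable_coefficient[where g = g and gs = gs] by blast
  define a' where "a' z = case_nat (\<beta> z) (a (z - \<beta> z *\<^sub>R g))" for z
  have "(\<lambda>z. a' z i) \<in> borel_measurable borel" for i
  proof (cases i)
    case 0
    then show ?thesis
      using \<beta>_meas by (simp add: a'_def)
  next
    case (Suc j)
    have "(\<lambda>z. z - \<beta> z *\<^sub>R g) \<in> borel_measurable borel"
      using \<beta>_meas by measurable
    from measurable_compose[OF this a_meas[of j]] show ?thesis
      by (simp add: a'_def Suc)
  qed
  moreover have "(\<forall>i<length (g # gs). a' z i \<in> {-1..1}) \<and>
      z = (\<Sum>i<length (g # gs). a' z i *\<^sub>R (g # gs) ! i)" if "z \<in> zonotope (g # gs)" for z
  proof -
    note rest = a[OF \<beta>[OF that, THEN conjunct2]]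
    have "z = \<beta> z *\<^sub>R g + (z - \<beta> z *\<^sub>R g)"
      by simp
    also have "\<dots> = \<beta> z *\<^sub>R g + (\<Sum>i<length gs. a (z - \<beta> z *\<^sub>R g) i *\<^sub>R gs ! i)"
      using rest by simp
    also have "\<dots> = (\<Sum>i<length (g # gs). a' z i *\<^sub>R (g # gs) ! i)"
      unfolding length_Cons sum.lessThan_Suc_shift by (simp add: a'_def)
    finally show ?thesis
      using \<beta>[OF that] rest by (auto simp: a'_def less_Suc_eq_0_disj)
  qed
  ultimately show ?case
    by blast
qed

lemma lin_image_zonotope_measurable_section:
  fixes B :: "real^'m^'n"
  assumes "is_zonotope U"
  obtains \<sigma> where "\<sigma> \<in> borel_measurable borel"
    and "\<And>z. z \<in> lin_image B U \<Longrightarrow> \<sigma> z \<in> U \<and> B *v \<sigma> z = z"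
proof -
  obtain c gs where U: "U = (+) c ` zonotope gs"
    using assms by (rule is_zonotopeE)
  define hs where "hs = map ((*v) B) gs"
  obtain a :: "real^'n \<Rightarrow> nat \<Rightarrow> real"
    where a_meas: "\<And>i. (\<lambda>z. a z i) \<in> borel_measurable borel"
    and a: "\<And>z. z \<in> zonotope hs \<Longrightarrow>
      (\<forall>i<length hs. a z i \<in> {-1..1}) \<and> z = (\<Sum>i<length hs. a z i *\<^sub>R hs ! i)"
    using zonotope_measurable_coefficients[of hs] by blast
  define \<sigma> where "\<sigma> z = c + (\<Sum>i<length gs. a (z - B *v c) i *\<^sub>R gs ! i)" for z
  show ?thesis
  proof
    show "\<sigma> \<in> borel_measurable borel"
      unfolding \<sigma>_def using a_meas by measurable
    fix z assume "z \<in> lin_image B U"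
    then have "z - B *v c \<in> zonotope hs"
      by (auto simp: U hs_def lin_image_translated_zonotope)
    note coeffs = a[OF this]
    have "\<sigma> z \<in> U"
      using coeffs unfolding U \<sigma>_def zonotope_def hs_def by auto
    moreover have "B *v \<sigma> z = z"
      using coeffs
      by (simp add: \<sigma>_def hs_def matrix_vector_right_distrib matrix_vector_mult_scaleR
          linear_sum[OF matrix_vector_mul_linear])
    ultimately show "\<sigma> z \<in> U \<and> B *v \<sigma> z = z" ..
  qed
qed

section \<open>Trajectories and forced responses\<close>

lemma trajs_restrict_lin_image:
  fixes B :: "real^'m^'n"
  assumes "u \<in> trajs T U" "t \<le> T"
  shows "(\<lambda>\<theta>. B *v u \<theta>) \<in> trajs t (lin_image B U)"
proof -
  have "u \<in> borel_measurable (lebesgue_on {0..t})"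
    using assms by (auto simp: trajs_def intro: measurable_restrict_mono)
  moreover have "(*v) B \<in> borel_measurable borel"
    by (intro borel_measurable_continuous_onI linear_continuous_on matrix_vector_mul_bounded_linear)
  ultimately have "(\<lambda>\<theta>. B *v u \<theta>) \<in> borel_measurable (lebesgue_on {0..t})"
    by (rule measurable_compose)
  then show ?thesis
    using assms by (auto simp: trajs_def lin_image_def)
qed

lemma trajs_lin_image_lift:
  fixes B :: "real^'m^'n"
  assumes U: "is_zonotope U" and s: "s \<in> trajs t (lin_image B U)" and "t \<le> T"
  obtains u where "u \<in> trajs T U" "\<And>\<theta>. \<theta> \<in> {0..t} \<Longrightarrow> B *v u \<theta> = s \<theta>"
proof -
  obtain \<sigma> where \<sigma>_meas: "\<sigma> \<in> borel_measurable borel"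
    and \<sigma>: "\<And>z. z \<in> lin_image B U \<Longrightarrow> \<sigma> z \<in> U \<and> B *v \<sigma> z = z"
    using lin_image_zonotope_measurable_section[OF U, where B = B] by blast
  obtain c where "c \<in> U"
    using U zero_in_zonotope by (metis is_zonotopeE add_0_right image_eqI)
  define u where "u \<theta> = (if \<theta> \<in> {0..t} then \<sigma> (s \<theta>) else c)" for \<theta>
  have "s \<in> borel_measurable (lebesgue_on {0..t})"
    using s by (simp add: trajs_def)
  then have "(\<lambda>\<theta>. \<sigma> (s \<theta>) - c) \<in> borel_measurable (lebesgue_on {0..t})"
    using \<sigma>_meas by measurable
  then have "(\<lambda>\<theta>. if \<theta> \<in> {0..t} then \<sigma> (s \<theta>) - c else 0) \<in> borel_measurable (lebesgue_on {0..T})"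
    using borel_measurable_if_lebesgue_on[of "{0..t}" "{0..T}" "\<lambda>\<theta>. \<sigma> (s \<theta>) - c"] \<open>t \<le> T\<close>
    by simp
  then have "(\<lambda>\<theta>. (if \<theta> \<in> {0..t} then \<sigma> (s \<theta>) - c else 0) + c) \<in> borel_measurable (lebesgue_on {0..T})"
    by (rule borel_measurable_add) simp
  moreover have "(\<lambda>\<theta>. (if \<theta> \<in> {0..t} then \<sigma> (s \<theta>) - c else 0) + c) = u"
    by (auto simp: u_def)
  moreover have "u \<theta> \<in> U" for \<theta>
    using \<sigma> s \<open>c \<in> U\<close> by (auto simp: u_def trajs_def)
  moreover have "B *v u \<theta> = s \<theta>" if "\<theta> \<in> {0..t}" for \<theta>
    using \<sigma> s that by (auto simp: u_def trajs_def)
  ultimately show ?thesis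
    using that by (auto simp: trajs_def)
qed

lemma integrable_on_matrix_vector_mult:
  fixes F :: "real \<Rightarrow> real^'m^'n" and v :: "real \<Rightarrow> real^'m"
  assumes F: "continuous_on {a..b} F"
    and v: "v \<in> borel_measurable (lebesgue_on {a..b})"
    and K: "compact K" "\<And>\<theta>. \<theta> \<in> {a..b} \<Longrightarrow> v \<theta> \<in> K"
  shows "(\<lambda>\<theta>. F \<theta> *v v \<theta>) integrable_on {a..b}"
proof -
  have mult_cont: "continuous_on UNIV (\<lambda>p. fst p *v snd p :: real^'n)"
    unfolding matrix_vector_mult_def by (intro continuous_intros)
  have "compact ((\<lambda>p. fst p *v snd p) ` (F ` {a..b} \<times> K))"
    using continuous_on_subset[OF mult_cont]
    by (intro compact_continuous_image compact_Times F K compact_Icc) auto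
  then obtain C where C: "\<forall>\<theta>\<in>{a..b}. \<forall>y\<in>K. norm (F \<theta> *v y) \<le> C"
    by (auto dest!: compact_imp_bounded simp: bounded_iff)
  show ?thesis
  proof (rule measurable_bounded_by_integrable_imp_integrable)
    show "(\<lambda>\<theta>. F \<theta> *v v \<theta>) \<in> borel_measurable (lebesgue_on {a..b})"
      by (rule borel_measurable_continuous_Pair[OF _ v mult_cont])
        (simp add: continuous_imp_measurable_on_sets_lebesgue F)
    show "norm (F \<theta> *v v \<theta>) \<le> C" if "\<theta> \<in> {a..b}" for \<theta>
      using C K(2) that by blast
  qed auto
qed

lemma integrable_on_mexp_convolution:
  assumes "compact S" "s \<in> trajs t S"
  shows "(\<lambda>\<theta>. mexp ((t - \<theta>) *\<^sub>R A) *v s \<theta>) integrable_on {0..t}"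
proof (rule integrable_on_matrix_vector_mult)
  show "continuous_on {0..t} (\<lambda>\<theta>. mexp ((t - \<theta>) *\<^sub>R A))"
    by (rule continuous_on_compose2[OF continuous_on_mexp_scaleR[of UNIV]])
      (auto intro: continuous_on_diff continuous_on_const continuous_on_id)
qed (use assms in \<open>auto simp: trajs_def\<close>)

definition forced_response :: "real^'n^'n \<Rightarrow> real \<Rightarrow> (real \<Rightarrow> real^'n) \<Rightarrow> real^'n" where
  "forced_response A t s = integral {0..t} (\<lambda>\<theta>. mexp ((t - \<theta>) *\<^sub>R A) *v s \<theta>)"

lemma partsol_eq_image: "partsol A S t = forced_response A t ` trajs t S"
  by (auto simp: partsol_def forced_response_def)

lemma partsol_lin_image_zonotope:
  fixes B :: "real^'m^'n"
  assumes U: "is_zonotope U" and "t \<le> T"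
  shows "partsol A (lin_image B U) t = (\<lambda>u. forced_response A t (\<lambda>\<theta>. B *v u \<theta>)) ` trajs T U"
proof (intro set_eqI iffI)
  fix z assume "z \<in> partsol A (lin_image B U) t"
  then obtain s where s: "s \<in> trajs t (lin_image B U)" and z: "z = forced_response A t s"
    by (auto simp: partsol_eq_image)
  obtain u where u: "u \<in> trajs T U" and Bu: "\<And>\<theta>. \<theta> \<in> {0..t} \<Longrightarrow> B *v u \<theta> = s \<theta>"
    using trajs_lin_image_lift[OF U s \<open>t \<le> T\<close>] by blast
  have "z = forced_response A t (\<lambda>\<theta>. B *v u \<theta>)"
    unfolding z forced_response_def by (rule integral_cong) (simp add: Bu)
  with u show "z \<in> (\<lambda>u. forced_response A t (\<lambda>\<theta>. B *v u \<theta>)) ` trajs T U"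
    by blast
next
  fix z assume "z \<in> (\<lambda>u. forced_response A t (\<lambda>\<theta>. B *v u \<theta>)) ` trajs T U"
  then obtain u where u: "u \<in> trajs T U" and z: "z = forced_response A t (\<lambda>\<theta>. B *v u \<theta>)"
    by blast
  have "(\<lambda>\<theta>. B *v u \<theta>) \<in> trajs t (lin_image B U)"
    using u \<open>t \<le> T\<close> by (rule trajs_restrict_lin_image)
  then show "z \<in> partsol A (lin_image B U) t"
    unfolding partsol_eq_image z by (rule imageI)
qed

lemma sol_eq_free_plus_forced_responses:
  assumes "is_zonotope U" "is_zonotope W" "u \<in> trajs T U" "w \<in> trajs T W" "t \<le> T"
  shows "sol A B E t x0 u w = mexp (t *\<^sub>R A) *v x0
    + forced_response A t (\<lambda>\<theta>. B *v u \<theta>) + forced_response A t (\<lambda>\<theta>. E *v w \<theta>)"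
proof -
  have "(\<lambda>\<theta>. mexp ((t - \<theta>) *\<^sub>R A) *v (B *v u \<theta>)) integrable_on {0..t}"
    using compact_lin_image_zonotope[OF assms(1)] trajs_restrict_lin_image[OF assms(3,5)]
    by (rule integrable_on_mexp_convolution)
  moreover have "(\<lambda>\<theta>. mexp ((t - \<theta>) *\<^sub>R A) *v (E *v w \<theta>)) integrable_on {0..t}"
    using compact_lin_image_zonotope[OF assms(2)] trajs_restrict_lin_image[OF assms(4,5)]
    by (rule integrable_on_mexp_convolution)
  ultimately show ?thesis
    unfolding sol_def forced_response_def
    by (simp add: matrix_vector_right_distrib add.assoc integral_add)
qed

theorem proposition3:
  fixes A :: "real^'n^'n" and B :: "real^'m^'n" and E :: "real^'r^'n"
    and U :: "(real^'m) set" and W :: "(real^'r) set" and Xend :: "(real^'n) set"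
    and tend t :: real
  assumes "is_zonotope U" and "is_zonotope W" and "is_polytope Xend"
    and "t \<in> {0..tend}"
  shows "AE_backreach A B E U W Xend tend t =
    lin_image (mexp ((- t) *\<^sub>R A))
      (mink_diff (mink_sum Xend (set_neg (partsol A (lin_image E W) t)))
                 (partsol A (lin_image B U) t))"
proof (rule set_eqI)
  fix x0
  let ?Z\<^sub>U = "partsol A (lin_image B U) t" and ?Z\<^sub>W = "partsol A (lin_image E W) t"
  let ?D = "mink_diff (mink_sum Xend (set_neg ?Z\<^sub>W)) ?Z\<^sub>U"
  define y where "y = mexp (t *\<^sub>R A) *v x0"
  have "t \<le> tend"
    using assms(4) by simp
  have sol: "sol A B E t x0 u w =
      y + forced_response A t (\<lambda>\<theta>. B *v u \<theta>) + forced_response A t (\<lambda>\<theta>. E *v w \<theta>)"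
    if "u \<in> trajs tend U" "w \<in> trajs tend W" for u w
    unfolding y_def by (rule sol_eq_free_plus_forced_responses[OF assms(1,2) that \<open>t \<le> tend\<close>])
  have "x0 \<in> AE_backreach A B E U W Xend tend t \<longleftrightarrow>
      (\<forall>u\<in>trajs tend U. \<exists>w\<in>trajs tend W.
        y + forced_response A t (\<lambda>\<theta>. B *v u \<theta>) + forced_response A t (\<lambda>\<theta>. E *v w \<theta>) \<in> Xend)"
    unfolding AE_backreach_def using sol by auto
  also have "\<dots> \<longleftrightarrow> (\<forall>p\<in>?Z\<^sub>U. \<exists>q\<in>?Z\<^sub>W. y + p + q \<in> Xend)"
    unfolding partsol_lin_image_zonotope[OF assms(1) \<open>t \<le> tend\<close>]
      partsol_lin_image_zonotope[OF assms(2) \<open>t \<le> tend\<close>] by blast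
  also have "\<dots> \<longleftrightarrow> y \<in> ?D"
    by (simp add: mem_mink_diff_iff mem_mink_sum_set_neg_iff add.assoc)
  also have "\<dots> \<longleftrightarrow> x0 \<in> lin_image (mexp ((- t) *\<^sub>R A)) ?D"
    unfolding y_def by (rule mem_lin_image_inverse_iff[symmetric]) (metis mexp_scaleR_inverse)+
  finally show "x0 \<in> AE_backreach A B E U W Xend tend t \<longleftrightarrow> x0 \<in> lin_image (mexp ((- t) *\<^sub>R A)) ?D" .
qed

end
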